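(* Let $m,n\in\mathbb{N}$ and let $\mathbf{G}$ be any one of the sequent calculi $\mathbf{GNA}_{m,n}$, $\mathbf{GN}^+\mathbf{A}_{m,n}$, $\mathbf{GNRA}_{m,n}$. Then $\mathbf{G}$ enjoys cut elimination: every sequent $\Gamma\Longrightarrow\Delta$ provable in $\mathbf{G}$ has a proof in $\mathbf{G}$ in which the cut rule is not used.
   Context: $\mathbb{N}$ includes $0$. Fix a countably infinite set $\mathrm{PropVar}$ of propositional variables. $\mathscr{L}_\Box$ is the set of formulas built from $\mathrm{PropVar}$ with $\land,\lor,\to,\bot,\Box$; $\top:=\bot\to\bot$, $\neg\varphi:=\varphi\to\bot$; $\Box^0\varphi:=\varphi$, $\Box^{k+1}\varphi:=\Box\Box^k\varphi$. Sequents. A sequent $\Gamma\Longrightarrow\Delta$ is a pair of finite sets of formulas; $\varphi,\Gamma$ means $\{\varphi\}\cup\Gamma$, $\Gamma,\Delta$ means $\Gamma\cup\Delta$, and empty sets are omitted. The calculus $\mathbf{LK}$. Initial sequents: $\varphi\Longrightarrow\varphi$ and $\bot\Longrightarrow$. Rules (premises / conclusion): ($\land$L) $\Gamma,\varphi_i\Longrightarrow\Delta$ / $\Gamma,\varphi_1\land\varphi_2\Longrightarrow\Delta$ ($i=1,2$); ($\land$R) $\Gamma\Longrightarrow\varphi_1,\Delta$ and $\Gamma\Longrightarrow\varphi_2,\Delta$ / $\Gamma\Longrightarrow\varphi_1\land\varphi_2,\Delta$; ($\lor$L) $\Gamma,\varphi_1\Longrightarrow\Delta$ and $\Gamma,\varphi_2\Longrightarrow\Delta$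 / $\Gamma,\varphi_1\lor\varphi_2\Longrightarrow\Delta$; ($\lor$R) $\Gamma\Longrightarrow\varphi_i,\Delta$ / $\Gamma\Longrightarrow\varphi_1\lor\varphi_2,\Delta$ ($i=1,2$); ($\to$L) $\Gamma_1\Longrightarrow\varphi,\Delta_1$ and $\Gamma_2,\psi\Longrightarrow\Delta_2$ / $\Gamma_1,\Gamma_2,\varphi\to\psi\Longrightarrow\Delta_1,\Delta_2$; ($\to$R) $\Gamma,\varphi\Longrightarrow\psi,\Delta$ / $\Gamma\Longrightarrow\varphi\to\psi,\Delta$; (wL) $\Gamma\Longrightarrow\Delta$ / $\Gamma,\varphi\Longrightarrow\Delta$; (wR) $\Gamma\Longrightarrow\Delta$ / $\Gamma\Longrightarrow\varphi,\Delta$; (cut) $\Gamma_1\Longrightarrow\Delta_1,\varphi$ and $\varphi,\Gamma_2\Longrightarrow\Delta_2$ / $\Gamma_1,\Gamma_2\Longrightarrow\Delta_1,\Delta_2$. Modal calculi (over $\mathscr{L}_\Box$). $\mathbf{GNA}_{m,n}$ has the initial sequents and all rules of $\mathbf{LK}$ (for formulas of $\mathscr{L}_\Box$), plus: (nec) $\Longrightarrow\varphi$ / $\Longrightarrow\Box\varphi$; (accL, only when $n>m$) $\Box^m\varphi,\Box^n\varphi,\Gamma\Longrightarrow\Delta$ / $\Box^n\varphi,\Gamma\Longrightarrow\Delta$; (accR, only when $m>n$) $\Gamma\Longrightarrow\Delta,\Box^m\varphi,\Box^n\varphi$ / $\Gamma\Longrightarrow\Delta,\Box^m\varphi$. $\mathbf{GN}^+\mathbf{A}_{m,n}$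 is $\mathbf{GNA}_{m,n}$ plus (rosbox, only when $m=0$ and $n\ge2$) $\Box\varphi\Longrightarrow$ / $\Box\Box\varphi\Longrightarrow$. $\mathbf{GNRA}_{m,n}$ is $\mathbf{GNA}_{m,n}$ plus (ros) $\varphi\Longrightarrow$ / $\Box\varphi\Longrightarrow$. *)

theory Defs
  imports Main "HOL-Library.FSet"
begin

type_synonym propvar = nat

datatype fm =
    Var propvar
  | Bot
  | And fm fm
  | Or fm fm
  | Imp fm fm
  | Box fm

abbreviation boxes :: "nat \<Rightarrow> fm \<Rightarrow> fm" where
  "boxes k \<phi> \<equiv> (Box ^^ k) \<phi>"

text \<open>A sequent is a pair of finite sets. In the rules below a comma is set insertion or union,
  so a displayed formula may also occur in its context, as in the usual set-based convention.\<close>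

type_synonym sequent = "fm fset \<times> fm fset"

datatype inf_rule =
    Init | InitBot
  | AndL | AndR | OrL | OrR | ImpL | ImpR
  | WL | WR
  | Cut
  | Nec
  | AccL nat nat
  | AccR nat nat
  | RosBox
  | Ros

text \<open>\<open>rule_inst r ps s\<close>: from the list \<open>ps\<close> of premises, the rule \<open>r\<close> infers the conclusion \<open>s\<close>.
  Initial sequents are rules without premises. The side conditions on \<open>m\<close> and \<open>n\<close> are part of the
  definitions of the calculi, not of the rules.\<close>

inductive rule_inst :: "inf_rule \<Rightarrow> sequent list \<Rightarrow> sequent \<Rightarrow> bool" where
  Init: "rule_inst Init [] ({|\<phi>|}, {|\<phi>|})"
| InitBot: "rule_inst InitBot [] ({|Bot|}, {||})"
| AndL1: "rule_inst AndL [(finsert \<phi>1 \<Gamma>, \<Delta>)] (finsert (And \<phi>1 \<phi>2) \<Gamma>, \<Delta>)"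
| AndL2: "rule_inst AndL [(finsert \<phi>2 \<Gamma>, \<Delta>)] (finsert (And \<phi>1 \<phi>2) \<Gamma>, \<Delta>)"
| AndR: "rule_inst AndR [(\<Gamma>, finsert \<phi>1 \<Delta>), (\<Gamma>, finsert \<phi>2 \<Delta>)] (\<Gamma>, finsert (And \<phi>1 \<phi>2) \<Delta>)"
| OrL: "rule_inst OrL [(finsert \<phi>1 \<Gamma>, \<Delta>), (finsert \<phi>2 \<Gamma>, \<Delta>)] (finsert (Or \<phi>1 \<phi>2) \<Gamma>, \<Delta>)"
| OrR1: "rule_inst OrR [(\<Gamma>, finsert \<phi>1 \<Delta>)] (\<Gamma>, finsert (Or \<phi>1 \<phi>2) \<Delta>)"
| OrR2: "rule_inst OrR [(\<Gamma>, finsert \<phi>2 \<Delta>)] (\<Gamma>, finsert (Or \<phi>1 \<phi>2) \<Delta>)"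
| ImpL: "rule_inst ImpL [(\<Gamma>1, finsert \<phi> \<Delta>1), (finsert \<psi> \<Gamma>2, \<Delta>2)]
           (finsert (Imp \<phi> \<psi>) (\<Gamma>1 |\<union>| \<Gamma>2), \<Delta>1 |\<union>| \<Delta>2)"
| ImpR: "rule_inst ImpR [(finsert \<phi> \<Gamma>, finsert \<psi> \<Delta>)] (\<Gamma>, finsert (Imp \<phi> \<psi>) \<Delta>)"
| WL: "rule_inst WL [(\<Gamma>, \<Delta>)] (finsert \<phi> \<Gamma>, \<Delta>)"
| WR: "rule_inst WR [(\<Gamma>, \<Delta>)] (\<Gamma>, finsert \<phi> \<Delta>)"
| Cut: "rule_inst Cut [(\<Gamma>1, finsert \<phi> \<Delta>1), (finsert \<phi> \<Gamma>2, \<Delta>2)] (\<Gamma>1 |\<union>| \<Gamma>2, \<Delta>1 |\<union>| \<Delta>2)"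
| Nec: "rule_inst Nec [({||}, {|\<phi>|})] ({||}, {|Box \<phi>|})"
| AccL: "rule_inst (AccL m n) [(finsert (boxes m \<phi>) (finsert (boxes n \<phi>) \<Gamma>), \<Delta>)]
           (finsert (boxes n \<phi>) \<Gamma>, \<Delta>)"
| AccR: "rule_inst (AccR m n) [(\<Gamma>, finsert (boxes m \<phi>) (finsert (boxes n \<phi>) \<Delta>))]
           (\<Gamma>, finsert (boxes m \<phi>) \<Delta>)"
| RosBox: "rule_inst RosBox [({|Box \<phi>|}, {||})] ({|Box (Box \<phi>)|}, {||})"
| Ros: "rule_inst Ros [({|\<phi>|}, {||})] ({|Box \<phi>|}, {||})"

type_synonym calculus = "inf_rule set"

definition LK :: calculus where
  "LK = {Init, InitBot, AndL, AndR, OrL, OrR, ImpL, ImpR, WL, WR, Cut}"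

definition GNA :: "nat \<Rightarrow> nat \<Rightarrow> calculus" where
  "GNA m n = LK \<union> {Nec}
     \<union> (if n > m then {AccL m n} else {})
     \<union> (if m > n then {AccR m n} else {})"

definition GNplusA :: "nat \<Rightarrow> nat \<Rightarrow> calculus" where
  "GNplusA m n = GNA m n \<union> (if m = 0 \<and> n \<ge> 2 then {RosBox} else {})"

definition GNRA :: "nat \<Rightarrow> nat \<Rightarrow> calculus" where
  "GNRA m n = GNA m n \<union> {Ros}"

text \<open>Derivation trees; every node carries the rule applied, its conclusion and the
  subderivations of its premises.\<close>

datatype deriv = Infer inf_rule (concl: sequent) "deriv list"

fun is_proof :: "calculus \<Rightarrow> deriv \<Rightarrow> bool" where
  "is_proof G (Infer r s ds) \<longleftrightarrow>
     r \<in> G \<and> rule_inst r (map concl ds) s \<and> (\<forall>d \<in> set ds. is_proof G d)"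

fun rules_used :: "deriv \<Rightarrow> inf_rule set" where
  "rules_used (Infer r s ds) = insert r (\<Union>d \<in> set ds. rules_used d)"

definition proof_of :: "calculus \<Rightarrow> deriv \<Rightarrow> sequent \<Rightarrow> bool" where
  "proof_of G d s \<longleftrightarrow> is_proof G d \<and> concl d = s"

definition provable :: "calculus \<Rightarrow> sequent \<Rightarrow> bool" where
  "provable G s \<longleftrightarrow> (\<exists>d. proof_of G d s)"

definition cut_free :: "deriv \<Rightarrow> bool" where
  "cut_free d \<longleftrightarrow> Cut \<notin> rules_used d"

definition cut_elimination :: "calculus \<Rightarrow> bool" where
  "cut_elimination G \<longleftrightarrow>
     (\<forall>\<Gamma> \<Delta>. provable G (\<Gamma>, \<Delta>) \<longrightarrow> (\<exists>d. proof_of G d (\<Gamma>, \<Delta>) \<and> cut_free d))"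

end

theory Submission
  imports Defs
begin

text \<open>
  The proof is semantic. Let \<open>H\<close> be the cut-free part of the calculus. The worlds are the
  \<open>H\<close>-unprovable sequents saturated under the rules read backwards; every unprovable sequent extends
  to a world, and the empty sequent is a world. Boolean connectives are evaluated as usual, and the
  value of \<open>Box \<phi>\<close> at a world \<open>(\<Gamma>, \<Delta>)\<close> is the least one that the truth lemma and the
  necessitation rule allow (\<open>Box \<phi> \<in> \<Gamma>\<close>, or \<open>\<phi>\<close> holds in all worlds) if \<open>n > m\<close>, and the greatest one
  that the truth lemma and the rule \<open>Ros\<close> allow (\<open>Box \<phi> \<notin> \<Delta>\<close>, and \<open>\<phi>\<close> holds in some world if
  \<open>Ros\<close> is present) if \<open>n \<le> m\<close>. With this choice every rule, cut included, is sound, and a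
  saturated unprovable sequent is refuted at itself. At the empty world only the second half of
  each definition matters, so that validity (respectively satisfiability) passes between \<open>\<phi>\<close> and
  \<open>Box \<phi>\<close>; this yields the accordion axiom where it is not enforced by saturation.
\<close>

section \<open>Provability as closure under rules\<close>

lemma provable_rule:
  assumes "r \<in> G" "rule_inst r ps s" "\<And>p. p \<in> set ps \<Longrightarrow> provable G p"
  shows "provable G s"
proof -
  obtain f where f: "\<And>p. p \<in> set ps \<Longrightarrow> proof_of G (f p) p"
    using assms(3) unfolding provable_def by metis
  have "map concl (map f ps) = ps"
    using f by (simp add: map_idI proof_of_def)
  then have "proof_of G (Infer r s (map f ps)) s"
    using assms(1,2) f by (simp add: proof_of_def)
  then show ?thesis
    unfolding provable_def by blast
qed

text \<open>Induction on derivation trees, restated so that soundness can be argued rule by rule on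
  sequents.\<close>

lemma provable_induct [consumes 1, case_names rule]:
  assumes "provable G s"
    and step: "\<And>r ps s. r \<in> G \<Longrightarrow> rule_inst r ps s \<Longrightarrow> (\<And>p. p \<in> set ps \<Longrightarrow> provable G p)
      \<Longrightarrow> (\<And>p. p \<in> set ps \<Longrightarrow> P p) \<Longrightarrow> P s"
  shows "P s"
proof -
  have "is_proof G d \<Longrightarrow> P (concl d)" for d
  proof (induction d)
    case (Infer r s ds)
    show ?case
      unfolding deriv.sel
    proof (rule step)
      show "r \<in> G" "rule_inst r (map concl ds) s"
        using Infer.prems by simp_all
      show "provable G p" if "p \<in> set (map concl ds)" for p
        using that Infer.prems by (auto simp: provable_def proof_of_def)
      show "P p" if "p \<in> set (map concl ds)" for p
        using that Infer by auto
    qed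
  qed
  then show ?thesis
    using assms(1) unfolding provable_def proof_of_def by blast
qed

lemma provable_weakening:
  assumes "WL \<in> G" "WR \<in> G" "provable G (\<Gamma>, \<Delta>)" "\<Gamma> |\<subseteq>| \<Gamma>'" "\<Delta> |\<subseteq>| \<Delta>'"
  shows "provable G (\<Gamma>', \<Delta>')"
proof -
  have L: "provable G (X |\<union>| \<Gamma>, \<Delta>)" for X
  proof (induction X)
    case (insert x X)
    show ?case
      using provable_rule[OF assms(1) rule_inst.WL[of "X |\<union>| \<Gamma>" \<Delta> x]] insert.IH by simp
  qed (use assms(3) in simp)
  have "provable G (\<Gamma>', Y |\<union>| \<Delta>)" for Y
  proof (induction Y)
    case empty
    then show ?case
      using L[of \<Gamma>'] assms(4) by (simp add: sup.absorb1)
  next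
    case (insert y Y)
    show ?case
      using provable_rule[OF assms(2) rule_inst.WR[of \<Gamma>' "Y |\<union>| \<Delta>" y]] insert.IH by simp
  qed
  from this[of \<Delta>'] show ?thesis
    using assms(5) by (simp add: sup.absorb1)
qed

text \<open>Being cut-free only restricts which rules occur in a tree, so cut elimination becomes a
  comparison of two calculi.\<close>

lemma cut_elimination_iff:
  "cut_elimination G \<longleftrightarrow> (\<forall>s. provable G s \<longrightarrow> provable (G - {Cut}) s)"
proof -
  have "is_proof (G - {Cut}) d \<longleftrightarrow> is_proof G d \<and> cut_free d" for d
    by (induction d) (auto simp: cut_free_def)
  then show ?thesis
    unfolding cut_elimination_def provable_def proof_of_def by (simp add: split_paired_all) metis
qed

section \<open>Subformulas and the valuation\<close>

primrec subformulas :: "fm \<Rightarrow> fm set" where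
  "subformulas (Var p) = {Var p}"
| "subformulas Bot = {Bot}"
| "subformulas (And a b) = insert (And a b) (subformulas a \<union> subformulas b)"
| "subformulas (Or a b) = insert (Or a b) (subformulas a \<union> subformulas b)"
| "subformulas (Imp a b) = insert (Imp a b) (subformulas a \<union> subformulas b)"
| "subformulas (Box a) = insert (Box a) (subformulas a)"

lemma finite_subformulas: "finite (subformulas a)"
  by (induction a) auto

lemma subformulas_refl: "a \<in> subformulas a"
  by (cases a) auto

lemma subformulas_trans: "b \<in> subformulas a \<Longrightarrow> subformulas b \<subseteq> subformulas a"
  by (induction a) auto

lemma boxes_subformula: "k \<le> l \<Longrightarrow> boxes k a \<in> subformulas (boxes l a)"
  by (induction l rule: dec_induct) (auto simp: subformulas_refl)

text \<open>\<open>K\<close> receives the formula \<open>a\<close> besides its truth set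
  \<open>val K a\<close>, because the choices of \<open>K\<close> below test whether
  \<open>Box a\<close> occurs in a side of the world. A box need not respect logical
  equivalence.\<close>

primrec val :: "(sequent \<Rightarrow> fm \<Rightarrow> (sequent \<Rightarrow> bool) \<Rightarrow> bool) \<Rightarrow> fm \<Rightarrow> sequent \<Rightarrow> bool" where
  "val K (Var p) w = (Var p |\<in>| fst w)"
| "val K Bot w = False"
| "val K (And a b) w = (val K a w \<and> val K b w)"
| "val K (Or a b) w = (val K a w \<or> val K b w)"
| "val K (Imp a b) w = (val K a w \<longrightarrow> val K b w)"
| "val K (Box a) w = K w a (val K a)"

section \<open>Worlds of a cut-free calculus\<close>

locale cut_free_calculus =
  fixes H :: calculus
  assumes LK_subset: "LK - {Cut} \<subseteq> H"
    and Nec_in: "Nec \<in> H"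
    and Cut_notin: "Cut \<notin> H"
    and AccL_less: "AccL m n \<in> H \<Longrightarrow> m < n"
    and AccR_less: "AccR m n \<in> H \<Longrightarrow> n < m"
begin

lemma rules_in:
  "Init \<in> H" "InitBot \<in> H" "AndL \<in> H" "AndR \<in> H" "OrL \<in> H" "OrR \<in> H" "ImpL \<in> H" "ImpR \<in> H"
  "WL \<in> H" "WR \<in> H"
  using LK_subset by (auto simp: LK_def)

lemmas weakening = provable_weakening[OF rules_in(9,10)]

text \<open>The clauses belong to the Boolean and accordion rules, which carry a context.
  \<open>Nec\<close>, \<open>Ros\<close> and \<open>RosBox\<close> carry none; read backwards they
  lead to other worlds, in \<open>world_Box_right\<close> and
  \<open>world_left_rule\<close>.\<close>

definition world :: "sequent \<Rightarrow> bool" where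
  "world w \<longleftrightarrow> \<not> provable H w
     \<and> (\<forall>a b. And a b |\<in>| fst w \<longrightarrow> a |\<in>| fst w \<and> b |\<in>| fst w)
     \<and> (\<forall>a b. And a b |\<in>| snd w \<longrightarrow> a |\<in>| snd w \<or> b |\<in>| snd w)
     \<and> (\<forall>a b. Or a b |\<in>| fst w \<longrightarrow> a |\<in>| fst w \<or> b |\<in>| fst w)
     \<and> (\<forall>a b. Or a b |\<in>| snd w \<longrightarrow> a |\<in>| snd w \<and> b |\<in>| snd w)
     \<and> (\<forall>a b. Imp a b |\<in>| fst w \<longrightarrow> a |\<in>| snd w \<or> b |\<in>| fst w)
     \<and> (\<forall>a b. Imp a b |\<in>| snd w \<longrightarrow> a |\<in>| fst w \<and> b |\<in>| snd w)
     \<and> (\<forall>m n a. AccL m n \<in> H \<longrightarrow> boxes n a |\<in>| fst w \<longrightarrow> boxes m a |\<in>| fst w)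
     \<and> (\<forall>m n a. AccR m n \<in> H \<longrightarrow> boxes m a |\<in>| snd w \<longrightarrow> boxes n a |\<in>| snd w)"

lemma world_unprovable: "world w \<Longrightarrow> \<not> provable H w"
  by (simp add: world_def)

lemma world_saturated:
  assumes "world w"
  shows "And a b |\<in>| fst w \<Longrightarrow> a |\<in>| fst w \<and> b |\<in>| fst w"
    and "And a b |\<in>| snd w \<Longrightarrow> a |\<in>| snd w \<or> b |\<in>| snd w"
    and "Or a b |\<in>| fst w \<Longrightarrow> a |\<in>| fst w \<or> b |\<in>| fst w"
    and "Or a b |\<in>| snd w \<Longrightarrow> a |\<in>| snd w \<and> b |\<in>| snd w"
    and "Imp a b |\<in>| fst w \<Longrightarrow> a |\<in>| snd w \<or> b |\<in>| fst w"
    and "Imp a b |\<in>| snd w \<Longrightarrow> a |\<in>| fst w \<and> b |\<in>| snd w"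
    and "AccL m n \<in> H \<Longrightarrow> boxes n a |\<in>| fst w \<Longrightarrow> boxes m a |\<in>| fst w"
    and "AccR m n \<in> H \<Longrightarrow> boxes m a |\<in>| snd w \<Longrightarrow> boxes n a |\<in>| snd w"
  using assms unfolding world_def by blast+

text \<open>Every rule except \<open>Cut\<close> leaves at least one formula in its
  conclusion.\<close>

lemma not_provable_empty: "\<not> provable H ({||}, {||})"
proof
  assume "provable H ({||}, {||})"
  then obtain r ps where "r \<in> H" "rule_inst r ps ({||}, {||})"
    by (auto simp: provable_def proof_of_def elim!: is_proof.elims)
  then show False
    using Cut_notin by (auto elim: rule_inst.cases)
qed

lemma world_empty: "world ({||}, {||})"
  by (simp add: world_def not_provable_empty)

text \<open>If a saturation clause failed, maximality would make the premises of the matching rule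
  provable, and the rule would then prove the sequent itself.\<close>

lemma maximal_imp_world:
  assumes unprov: "\<not> provable H (\<Gamma>, \<Delta>)"
    and sub: "fset \<Gamma> \<union> fset \<Delta> \<subseteq> C"
    and closed: "\<And>a. a \<in> C \<Longrightarrow> subformulas a \<subseteq> C"
    and maxL: "\<And>a. a \<in> C \<Longrightarrow> \<not> provable H (finsert a \<Gamma>, \<Delta>) \<Longrightarrow> a |\<in>| \<Gamma>"
    and maxR: "\<And>a. a \<in> C \<Longrightarrow> \<not> provable H (\<Gamma>, finsert a \<Delta>) \<Longrightarrow> a |\<in>| \<Delta>"
  shows "world (\<Gamma>, \<Delta>)"
proof -
  \<comment> \<open>The principal formula is already present, so the conclusion of each rule
    collapses to the current sequent.\<close>
  note [simp] = finsert_absorb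
  have inC: "b \<in> C" if "b \<in> subformulas a" "a |\<in>| \<Gamma> \<or> a |\<in>| \<Delta>" for a b
    using that sub closed by blast
  have 1: "a |\<in>| \<Gamma> \<and> b |\<in>| \<Gamma>" if "And a b |\<in>| \<Gamma>" for a b
  proof
    have "a \<in> C" "b \<in> C"
      using inC[of _ "And a b"] that by (auto simp: subformulas_refl)
    then show "a |\<in>| \<Gamma>" "b |\<in>| \<Gamma>"
      using maxL unprov that
        provable_rule[OF rules_in(3) rule_inst.AndL1[of a \<Gamma> \<Delta> b]]
        provable_rule[OF rules_in(3) rule_inst.AndL2[of b \<Gamma> \<Delta> a]] by auto
  qed
  have 2: "a |\<in>| \<Delta> \<or> b |\<in>| \<Delta>" if "And a b |\<in>| \<Delta>" for a b
  proof -
    have "a \<in> C" "b \<in> C"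
      using inC[of _ "And a b"] that by (auto simp: subformulas_refl)
    then show ?thesis
      using maxR unprov that
        provable_rule[OF rules_in(4) rule_inst.AndR[of \<Gamma> a \<Delta> b]] by auto
  qed
  have 3: "a |\<in>| \<Gamma> \<or> b |\<in>| \<Gamma>" if "Or a b |\<in>| \<Gamma>" for a b
  proof -
    have "a \<in> C" "b \<in> C"
      using inC[of _ "Or a b"] that by (auto simp: subformulas_refl)
    then show ?thesis
      using maxL unprov that
        provable_rule[OF rules_in(5) rule_inst.OrL[of a \<Gamma> \<Delta> b]] by auto
  qed
  have 4: "a |\<in>| \<Delta> \<and> b |\<in>| \<Delta>" if "Or a b |\<in>| \<Delta>" for a b
  proof
    have "a \<in> C" "b \<in> C"
      using inC[of _ "Or a b"] that by (auto simp: subformulas_refl)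
    then show "a |\<in>| \<Delta>" "b |\<in>| \<Delta>"
      using maxR unprov that
        provable_rule[OF rules_in(6) rule_inst.OrR1[of \<Gamma> a \<Delta> b]]
        provable_rule[OF rules_in(6) rule_inst.OrR2[of \<Gamma> b \<Delta> a]] by auto
  qed
  have 5: "a |\<in>| \<Delta> \<or> b |\<in>| \<Gamma>" if "Imp a b |\<in>| \<Gamma>" for a b
  proof -
    have "a \<in> C" "b \<in> C"
      using inC[of _ "Imp a b"] that by (auto simp: subformulas_refl)
    then show ?thesis
      using maxL maxR unprov that
        provable_rule[OF rules_in(7) rule_inst.ImpL[of \<Gamma> a \<Delta> b \<Gamma> \<Delta>]] by auto
  qed
  have 6: "a |\<in>| \<Gamma> \<and> b |\<in>| \<Delta>" if "Imp a b |\<in>| \<Delta>" for a b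
  proof -
    have C: "a \<in> C" "b \<in> C"
      using inC[of _ "Imp a b"] that by (auto simp: subformulas_refl)
    \<comment> \<open>The premise of \<open>ImpR\<close> adds a formula on both sides at once,
      whereas maximality speaks of a single addition; weakening bridges the two.\<close>
    have "\<not> provable H (finsert a \<Gamma>, finsert b \<Delta>)"
      using unprov that provable_rule[OF rules_in(8) rule_inst.ImpR[of a \<Gamma> b \<Delta>]] by auto
    then have "\<not> provable H (finsert a \<Gamma>, \<Delta>)" "\<not> provable H (\<Gamma>, finsert b \<Delta>)"
      using weakening by blast+
    then show ?thesis
      using C maxL maxR by blast
  qed
  have 7: "boxes m a |\<in>| \<Gamma>" if "AccL m n \<in> H" "boxes n a |\<in>| \<Gamma>" for m n a
  proof -
    \<comment> \<open>The side condition \<open>m < n\<close> makes \<open>boxes m a\<close> a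
      subformula of \<open>boxes n a\<close>, so saturation does not leave \<open>C\<close>.\<close>
    have "boxes m a \<in> C"
      using inC[OF boxes_subformula] AccL_less that by (meson less_imp_le)
    then show ?thesis
      using maxL unprov that provable_rule[OF that(1) rule_inst.AccL[of m n a \<Gamma> \<Delta>]] by auto
  qed
  have 8: "boxes n a |\<in>| \<Delta>" if "AccR m n \<in> H" "boxes m a |\<in>| \<Delta>" for m n a
  proof -
    have "boxes n a \<in> C"
      using inC[OF boxes_subformula] AccR_less that by (meson less_imp_le)
    moreover have "\<not> provable H (\<Gamma>, finsert (boxes n a) \<Delta>)"
      using unprov that provable_rule[OF that(1) rule_inst.AccR[of m n \<Gamma> a \<Delta>]] by auto
    ultimately show ?thesis
      by (rule maxR)
  qed
  show ?thesis
    unfolding world_def fst_conv snd_conv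
    by (intro conjI unprov allI impI) (rule 7 8, assumption+ | blast dest: 1 2 3 4 5 6)+
qed

text \<open>Saturation only adds subformulas, so an unprovable extension of greatest size inside the
  finite set \<open>C\<close> is a world.\<close>

lemma unprovable_extends_to_world:
  assumes "\<not> provable H (\<Gamma>, \<Delta>)"
  shows "\<exists>w. world w \<and> \<Gamma> |\<subseteq>| fst w \<and> \<Delta> |\<subseteq>| snd w"
proof -
  define C where "C = (\<Union>a \<in> fset \<Gamma> \<union> fset \<Delta>. subformulas a)"
  have finC: "finite C"
    by (auto simp: C_def finite_subformulas)
  have closed: "subformulas a \<subseteq> C" if "a \<in> C" for a
    using that subformulas_trans unfolding C_def by blast
  define P where "P = (\<lambda>w. \<not> provable H w \<and> \<Gamma> |\<subseteq>| fst w \<and> \<Delta> |\<subseteq>| snd w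
    \<and> fset (fst w) \<union> fset (snd w) \<subseteq> C)"
  have "P (\<Gamma>, \<Delta>)"
    using assms subformulas_refl by (auto simp: P_def C_def)
  moreover have "fcard (fst w) + fcard (snd w) < Suc (2 * card C)" if "P w" for w
  proof -
    have "card (fset (fst w)) \<le> card C" "card (fset (snd w)) \<le> card C"
      using that finC by (auto simp: P_def intro: card_mono)
    then show ?thesis
      by (simp add: fcard.rep_eq)
  qed
  ultimately have "\<exists>w. P w \<and> (\<forall>u. P u
      \<longrightarrow> fcard (fst u) + fcard (snd u) \<le> fcard (fst w) + fcard (snd w))"
    by (intro ex_has_greatest_nat[where b = "Suc (2 * card C)" and k = "(\<Gamma>, \<Delta>)"]) simp_all
  then obtain w where w: "P w"
    and max: "\<And>u. P u \<Longrightarrow> fcard (fst u) + fcard (snd u) \<le> fcard (fst w) + fcard (snd w)"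
    by blast
  obtain \<Gamma>' \<Delta>' where eq: "w = (\<Gamma>', \<Delta>')"
    by (cases w)
  have "world (\<Gamma>', \<Delta>')"
  proof (rule maximal_imp_world[OF _ _ closed])
    show "\<not> provable H (\<Gamma>', \<Delta>')" "fset \<Gamma>' \<union> fset \<Delta>' \<subseteq> C"
      using w by (auto simp: P_def eq)
    show "a |\<in>| \<Gamma>'" if "a \<in> C" "\<not> provable H (finsert a \<Gamma>', \<Delta>')" for a
    proof (rule ccontr)
      assume "a |\<notin>| \<Gamma>'"
      moreover have "P (finsert a \<Gamma>', \<Delta>')"
        using w that by (auto simp: P_def eq)
      ultimately show False
        using max[of "(finsert a \<Gamma>', \<Delta>')"] by (simp add: eq fcard_finsert_disjoint)
    qed
    show "a |\<in>| \<Delta>'" if "a \<in> C" "\<not> provable H (\<Gamma>', finsert a \<Delta>')" for a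
    proof (rule ccontr)
      assume "a |\<notin>| \<Delta>'"
      moreover have "P (\<Gamma>', finsert a \<Delta>')"
        using w that by (auto simp: P_def eq)
      ultimately show False
        using max[of "(\<Gamma>', finsert a \<Delta>')"] by (simp add: eq fcard_finsert_disjoint)
    qed
  qed
  then show ?thesis
    using w by (auto simp: P_def eq)
qed

lemma world_disjoint: "world w \<Longrightarrow> a |\<in>| fst w \<Longrightarrow> a |\<notin>| snd w"
proof
  assume w: "world w" and a: "a |\<in>| fst w" "a |\<in>| snd w"
  have "provable H ({|a|}, {|a|})"
    by (rule provable_rule[OF rules_in(1) rule_inst.Init]) simp
  then have "provable H (fst w, snd w)"
    by (rule weakening) (use a in auto)
  then show False
    using world_unprovable[OF w] by simp
qed

lemma world_no_Bot: "world w \<Longrightarrow> Bot |\<notin>| fst w"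
proof
  assume w: "world w" and a: "Bot |\<in>| fst w"
  have "provable H ({|Bot|}, {||})"
    by (rule provable_rule[OF rules_in(2) rule_inst.InitBot]) simp
  then have "provable H (fst w, snd w)"
    by (rule weakening) (use a in auto)
  then show False
    using world_unprovable[OF w] by simp
qed

text \<open>Otherwise \<open>Nec\<close> and weakening would prove \<open>w\<close>. The new world
  extends the sequent with \<open>a\<close> alone on the right.\<close>

lemma world_Box_right:
  assumes "world w" "Box a |\<in>| snd w"
  shows "\<exists>u. world u \<and> a |\<in>| snd u"
proof -
  have "\<not> provable H ({||}, {|a|})"
  proof
    assume "provable H ({||}, {|a|})"
    then have "provable H ({||}, {|Box a|})"
      using provable_rule[OF Nec_in rule_inst.Nec] by simp
    then have "provable H (fst w, snd w)"
      by (rule weakening) (use assms in auto)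
    then show False
      using world_unprovable[OF assms(1)] by simp
  qed
  then show ?thesis
    using unprovable_extends_to_world by blast
qed

text \<open>The left-hand counterpart of \<open>world_Box_right\<close>, stated for a variable rule
  so as to serve both \<open>Ros\<close> and \<open>RosBox\<close>.\<close>

lemma world_left_rule:
  assumes "r \<in> H" "rule_inst r [({|a|}, {||})] ({|b|}, {||})" "world w" "b |\<in>| fst w"
  shows "\<exists>u. world u \<and> a |\<in>| fst u"
proof -
  have "\<not> provable H ({|a|}, {||})"
  proof
    assume "provable H ({|a|}, {||})"
    then have "provable H ({|b|}, {||})"
      using provable_rule[OF assms(1,2)] by simp
    then have "provable H (fst w, snd w)"
      by (rule weakening) (use assms in auto)
    then show False
      using world_unprovable[OF assms(3)] by simp
  qed
  then show ?thesis
    using unprovable_extends_to_world by blast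
qed

section \<open>Truth, soundness and completeness for an abstract box evaluation\<close>

lemma truth_lemma:
  assumes left: "\<And>w a X. \<lbrakk>world w; Box a |\<in>| fst w; \<And>u. world u \<Longrightarrow> a |\<in>| fst u \<Longrightarrow> X u\<rbrakk> \<Longrightarrow> K w a X"
    and right: "\<And>w a X. \<lbrakk>world w; Box a |\<in>| snd w; \<And>u. world u \<Longrightarrow> a |\<in>| snd u \<Longrightarrow> \<not> X u\<rbrakk> \<Longrightarrow> \<not> K w a X"
    and "world w"
  shows "(a |\<in>| fst w \<longrightarrow> val K a w) \<and> (a |\<in>| snd w \<longrightarrow> \<not> val K a w)"
  using assms(3)
proof (induction a arbitrary: w)
  case (Var p)
  then show ?case
    unfolding val.simps using world_disjoint by blast
next
  case Bot
  then show ?case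
    using world_no_Bot by auto
next
  case (And a b)
  then show ?case
    unfolding val.simps using world_saturated(1,2) by blast
next
  case (Or a b)
  then show ?case
    unfolding val.simps using world_saturated(3,4) by blast
next
  case (Imp a b)
  then show ?case
    unfolding val.simps using world_saturated(5,6) by blast
next
  \<comment> \<open>The induction hypothesis, available at every world, supplies the conditions on
    \<open>X\<close> in \<open>left\<close> and \<open>right\<close> for
    \<open>X = val K a\<close>.\<close>
  case (Box a)
  then show ?case
    using left right by simp
qed

text \<open>\<open>Cut\<close> is sound because each formula is either true or false at a world. The
  world varies in the induction, since the rules without context use their premise at all
  worlds.\<close>

lemma soundness:
  assumes Nec: "\<And>a w. (\<And>u. world u \<Longrightarrow> val K a u) \<Longrightarrow> world w \<Longrightarrow> val K (Box a) w"
    and Acc: "\<And>m n a w. \<lbrakk>AccL m n \<in> H \<or> AccR m n \<in> H; world w; val K (boxes n a) w\<rbrakk>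
      \<Longrightarrow> val K (boxes m a) w"
    and Ros: "\<And>a w. \<lbrakk>Ros \<in> H; \<And>u. world u \<Longrightarrow> \<not> val K a u; world w\<rbrakk> \<Longrightarrow> \<not> val K (Box a) w"
    and RosBox: "\<And>a w. \<lbrakk>RosBox \<in> H; \<And>u. world u \<Longrightarrow> \<not> val K (Box a) u; world w\<rbrakk>
      \<Longrightarrow> \<not> val K (Box (Box a)) w"
    and "provable (insert Cut H) s" "world w"
  shows "(\<forall>a. a |\<in>| fst s \<longrightarrow> val K a w) \<longrightarrow> (\<exists>a. a |\<in>| snd s \<and> val K a w)"
  using assms(5,6)
proof (induction arbitrary: w rule: provable_induct)
  case (rule r ps s)
  have IH: "\<forall>p\<in>set ps. (\<forall>a. a |\<in>| fst p \<longrightarrow> val K a u) \<longrightarrow> (\<exists>a. a |\<in>| snd p \<and> val K a u)"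
    if "world u" for u
    using rule.IH that by blast
  \<comment> \<open>Separates the inserted formula from the context in the existential over a
    succedent.\<close>
  note distrib = conj_disj_distribR ex_disj_distrib
  from \<open>rule_inst r ps s\<close> show ?case
  proof cases
    case (Nec a)
    then have "val K a u" if "world u" for u
      using IH[OF that] by auto
    then show ?thesis
      using Nec assms(1) \<open>world w\<close> by auto
  next
    case (AccL m n a \<Gamma> \<Delta>)
    \<comment> \<open>Both accordion rules rest on this implication: it lets
      \<open>boxes m a\<close> be dropped on the left, or \<open>boxes n a\<close> on the
      right.\<close>
    then have "val K (boxes n a) w \<Longrightarrow> val K (boxes m a) w"
      using Acc \<open>r \<in> insert Cut H\<close> \<open>world w\<close> by blast
    then show ?thesis
      using IH[OF \<open>world w\<close>] AccL by auto
  next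
    case (AccR m n \<Gamma> a \<Delta>)
    then have "val K (boxes n a) w \<Longrightarrow> val K (boxes m a) w"
      using Acc \<open>r \<in> insert Cut H\<close> \<open>world w\<close> by blast
    then show ?thesis
      using IH[OF \<open>world w\<close>] AccR by (auto simp: distrib)
  next
    case (RosBox a)
    then have "\<not> val K (Box a) u" if "world u" for u
      using IH[OF that] by auto
    then have "\<not> val K (Box (Box a)) w"
      using assms(4) RosBox \<open>r \<in> insert Cut H\<close> \<open>world w\<close> by blast
    then show ?thesis
      using RosBox by auto
  next
    case (Ros a)
    then have "\<not> val K a u" if "world u" for u
      using IH[OF that] by auto
    then have "\<not> val K (Box a) w"
      using assms(3) Ros \<open>r \<in> insert Cut H\<close> \<open>world w\<close> by blast
    then show ?thesis
      using Ros by auto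
  qed (use IH[OF \<open>world w\<close>] in \<open>auto simp: distrib\<close>)
qed

lemma completeness:
  assumes truth: "\<And>w a. world w \<Longrightarrow> (a |\<in>| fst w \<longrightarrow> val K a w) \<and> (a |\<in>| snd w \<longrightarrow> \<not> val K a w)"
    and valid: "\<And>w. world w
      \<Longrightarrow> (\<forall>a. a |\<in>| fst s \<longrightarrow> val K a w) \<longrightarrow> (\<exists>a. a |\<in>| snd s \<and> val K a w)"
  shows "provable H s"
proof (rule ccontr)
  assume "\<not> provable H s"
  then obtain w where w: "world w" "fst s |\<subseteq>| fst w" "snd s |\<subseteq>| snd w"
    using unprovable_extends_to_world[of "fst s" "snd s"] by auto
  with truth valid show False
    by blast
qed

section \<open>The least and the greatest evaluation of the box\<close>

lemma cut_admissible_AccL: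
  assumes "\<And>m n. AccR m n \<notin> H" "provable (insert Cut H) s"
  shows "provable H s"
proof -
  define K where "K = (\<lambda>(w :: sequent) a X. Box a |\<in>| fst w \<or> (\<forall>u. world u \<longrightarrow> X u))"
  have truth: "(a |\<in>| fst w \<longrightarrow> val K a w) \<and> (a |\<in>| snd w \<longrightarrow> \<not> val K a w)" if "world w" for w a
    using that
  proof (rule truth_lemma[rotated -1])
    \<comment> \<open>Disjointness of the two sides refutes the first half of \<open>K\<close>, a
      world with \<open>a\<close> on the right the second.\<close>
    show "\<not> K w a X"
      if "world w" "Box a |\<in>| snd w" "\<And>u. world u \<Longrightarrow> a |\<in>| snd u \<Longrightarrow> \<not> X u" for w a X
      using that world_disjoint world_Box_right unfolding K_def by blast
  qed (simp add: K_def)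
  have unbox: "\<forall>u. world u \<longrightarrow> val K (boxes k a) u"
    if "k \<le> l" "\<forall>u. world u \<longrightarrow> val K (boxes l a) u" for k l a
    using that
  proof (induction l rule: dec_induct)
    case (step l)
    \<comment> \<open>The empty world has no box on its left, so a box can be true there only
      because its body is valid.\<close>
    from step.prems[rule_format, OF world_empty] have "\<forall>u. world u \<longrightarrow> val K (boxes l a) u"
      by (simp add: K_def)
    then show ?case
      by (rule step.IH)
  qed
  show ?thesis
  proof (rule completeness[OF truth soundness[OF _ _ _ _ assms(2)]])
    show "val K (boxes m a) w"
      if A: "AccL m n \<in> H \<or> AccR m n \<in> H" and w: "world w" and v: "val K (boxes n a) w" for m n a w
    proof -
      have A: "AccL m n \<in> H"
        using A assms(1) by blast
      \<comment> \<open>Since \<open>n\<close> is positive, \<open>boxes n a\<close> is the box of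
        \<open>boxes l a\<close>, and \<open>unbox\<close> leads from \<open>l\<close> down to
        \<open>m\<close>.\<close>
      then obtain l where l: "n = Suc l" "m \<le> l"
        using AccL_less by (metis less_imp_Suc_add le_add1)
      from v l have "boxes n a |\<in>| fst w \<or> (\<forall>u. world u \<longrightarrow> val K (boxes l a) u)"
        by (simp add: K_def)
      then show ?thesis
      proof
        assume "boxes n a |\<in>| fst w"
        then have "boxes m a |\<in>| fst w"
          using w A world_saturated(7) by blast
        then show ?thesis
          using truth w by blast
      next
        assume "\<forall>u. world u \<longrightarrow> val K (boxes l a) u"
        from unbox[OF l(2) this] show ?thesis
          using w by blast
      qed
    qed
    show "\<not> val K (Box a) w"
      if "Ros \<in> H" "\<And>u. world u \<Longrightarrow> \<not> val K a u" "world w" for a w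
    proof
      assume "val K (Box a) w"
      then have "Box a |\<in>| fst w \<or> (\<forall>u. world u \<longrightarrow> val K a u)"
        by (simp add: K_def)
      \<comment> \<open>In the first case \<open>Ros\<close> yields a world with \<open>a\<close> on
        its left, where \<open>a\<close> is true; in the second, \<open>a\<close> is true at
        \<open>w\<close>.\<close>
      then show False
        using that truth world_left_rule[OF that(1) rule_inst.Ros, of w a] by blast
    qed
    show "\<not> val K (Box (Box a)) w"
      if "RosBox \<in> H" "\<And>u. world u \<Longrightarrow> \<not> val K (Box a) u" "world w" for a w
    proof
      assume "val K (Box (Box a)) w"
      then have "Box (Box a) |\<in>| fst w \<or> (\<forall>u. world u \<longrightarrow> val K (Box a) u)"
        by (simp add: K_def)
      then show False
        using that truth world_left_rule[OF that(1) rule_inst.RosBox, of w a] by blast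
    qed
  qed (simp_all add: K_def)
qed

lemma cut_admissible_AccR:
  assumes "\<And>m n. AccL m n \<notin> H" "RosBox \<notin> H" "provable (insert Cut H) s"
  shows "provable H s"
proof -
  define K where "K = (\<lambda>(w :: sequent) a X. Box a |\<notin>| snd w \<and> (Ros \<in> H \<longrightarrow> (\<exists>u. world u \<and> X u)))"
  have val_Box: "val K (Box a) w \<longleftrightarrow> Box a |\<notin>| snd w \<and> (Ros \<in> H \<longrightarrow> (\<exists>u. world u \<and> val K a u))"
    for a w
    by (simp only: val.simps K_def)
  have truth: "(a |\<in>| fst w \<longrightarrow> val K a w) \<and> (a |\<in>| snd w \<longrightarrow> \<not> val K a w)" if "world w" for w a
    using that
  proof (rule truth_lemma[rotated -1])
    \<comment> \<open>If \<open>Ros\<close> is present, it turns the occurrence of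
      \<open>Box a\<close> on the left into a world satisfying \<open>a\<close>.\<close>
    show "K w a X"
      if "world w" "Box a |\<in>| fst w" "\<And>u. world u \<Longrightarrow> a |\<in>| fst u \<Longrightarrow> X u" for w a X
      using that world_disjoint world_left_rule[OF _ rule_inst.Ros] unfolding K_def by blast
  qed (simp add: K_def)
  have rebox: "\<exists>u. world u \<and> val K (boxes l a) u"
    if "k \<le> l" "\<exists>u. world u \<and> val K (boxes k a) u" for k l a
    using that
  proof (induction l rule: dec_induct)
    case (step l)
    \<comment> \<open>The empty world has no box on its right, so a box is true there as soon as its
      body holds somewhere.\<close>
    then have "val K (boxes (Suc l) a) ({||}, {||})"
      by (simp add: val_Box del: val.simps)
    then show ?case
      using world_empty by blast
  qed
  show ?thesis
  proof (rule completeness[OF truth soundness[OF _ _ _ _ assms(3)]])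
    show "val K (Box a) w" if "\<And>u. world u \<Longrightarrow> val K a u" "world w" for a w
    proof -
      \<comment> \<open>Otherwise some world would have \<open>a\<close> on its right and refute it.
        The world \<open>w\<close> itself then serves as witness for the second half of
        \<open>K\<close>.\<close>
      have "Box a |\<notin>| snd w"
        using world_Box_right truth that by blast
      then show ?thesis
        using that unfolding val_Box by blast
    qed
    show "val K (boxes m a) w"
      if A: "AccL m n \<in> H \<or> AccR m n \<in> H" and w: "world w" and v: "val K (boxes n a) w" for m n a w
    proof -
      have A: "AccR m n \<in> H"
        using A assms(1) by blast
      then obtain l where l: "m = Suc l" "n \<le> l"
        using AccR_less by (metis less_imp_Suc_add le_add1)
      \<comment> \<open>Saturation would otherwise put \<open>boxes n a\<close> on the right of
        \<open>w\<close>, contrary to its truth there.\<close>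
      have "boxes m a |\<notin>| snd w"
        using truth w v A world_saturated(8) by blast
      moreover have "\<exists>u. world u \<and> val K (boxes l a) u"
        using rebox[OF l(2)] v w by blast
      ultimately show ?thesis
        by (simp add: l(1) val_Box del: val.simps)
    qed
  qed (use assms(2) in \<open>simp_all add: val_Box del: val.simps\<close>)
qed

end

theorem theorem3p4:
  fixes m n :: nat and G :: calculus
  assumes "G \<in> {GNA m n, GNplusA m n, GNRA m n}"
  shows "cut_elimination G"
proof -
  note defs = GNA_def GNplusA_def GNRA_def LK_def
  interpret cut_free_calculus "G - {Cut}"
    using assms by unfold_locales (auto simp: defs split: if_splits)
  have G: "insert Cut (G - {Cut}) = G"
    using assms by (auto simp: defs)
  show ?thesis
    unfolding cut_elimination_iff
  proof (intro allI impI)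
    fix s assume s: "provable G s"
    show "provable (G - {Cut}) s"
    proof (cases "n > m")
      case True
      then have "AccR i j \<notin> G - {Cut}" for i j
        using assms by (auto simp: defs split: if_splits)
      then show ?thesis
        using cut_admissible_AccL s G by simp
    next
      case False
      \<comment> \<open>This case includes \<open>m = n\<close>, where neither accordion rule is
        present. \<open>RosBox\<close> is absent because its condition \<open>m = 0\<close>,
        \<open>n \<ge> 2\<close> forces \<open>n > m\<close>.\<close>
      then have "AccL i j \<notin> G - {Cut}" "RosBox \<notin> G - {Cut}" for i j
        using assms by (auto simp: defs split: if_splits)
      then show ?thesis
        using cut_admissible_AccR s G by simp
    qed
  qed
qed

end
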